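(* Let $G$ be a connected cograph (with at least two vertices). Then $\chi_{td}(G)=\chi(G)$. Moreover, for every TD-coloring $\mathcal{H}$ of $G$ using $\chi_{td}(G)$ colors, the minimum number of color classes of $\mathcal{H}$ forming a family $C_0$ such that every vertex of $G$ is adjacent to all vertices of some class in $C_0$ is exactly $2$.
   Context: All graphs are finite, simple, undirected and without isolated vertices. A cograph is a graph with no induced path on four vertices. $\chi(G)$ is the chromatic number. A total dominator coloring (TD-coloring) of $G$ is a proper vertex coloring such that every vertex is adjacent to all vertices of some color class; $\chi_{td}(G)$ is the minimum number of colors in a TD-coloring. *)

theory Defs
  imports "Graph_Theory.Digraph_Component"
begin

text \<open>
  Finite simple undirected graphs are the symmetric digraphs of the locale \<open>graph\<close>; adjacency of
  \<open>u\<close> and \<open>v\<close> is \<open>u \<rightarrow>\<^bsub>G\<^esub> v\<close>.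
\<close>

definition induced_path :: "('a,'b) pre_digraph \<Rightarrow> 'a list \<Rightarrow> bool" where
  "induced_path G xs \<longleftrightarrow> distinct xs \<and> set xs \<subseteq> verts G \<and>
     (\<forall>i < length xs. \<forall>j < length xs. (xs ! i \<rightarrow>\<^bsub>G\<^esub> xs ! j) \<longleftrightarrow> (j = Suc i \<or> i = Suc j))"

definition cograph :: "('a,'b) pre_digraph \<Rightarrow> bool" where
  "cograph G \<longleftrightarrow> \<not> (\<exists>xs. length xs = 4 \<and> induced_path G xs)"

definition proper_coloring :: "('a,'b) pre_digraph \<Rightarrow> ('a \<Rightarrow> nat) \<Rightarrow> bool" where
  "proper_coloring G c \<longleftrightarrow> (\<forall>u \<in> verts G. \<forall>v \<in> verts G. (u \<rightarrow>\<^bsub>G\<^esub> v) \<longrightarrow> c u \<noteq> c v)"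

text \<open>
  Only colors that occur on a vertex are counted, so color classes are nonempty. An empty class
  would make the condition of a total dominator coloring vacuous.
\<close>

definition num_colors :: "('a,'b) pre_digraph \<Rightarrow> ('a \<Rightarrow> nat) \<Rightarrow> nat" where
  "num_colors G c = card (c ` verts G)"

definition color_class :: "('a,'b) pre_digraph \<Rightarrow> ('a \<Rightarrow> nat) \<Rightarrow> nat \<Rightarrow> 'a set" where
  "color_class G c k = {v \<in> verts G. c v = k}"

definition color_classes :: "('a,'b) pre_digraph \<Rightarrow> ('a \<Rightarrow> nat) \<Rightarrow> 'a set set" where
  "color_classes G c = color_class G c ` (c ` verts G)"

definition chromatic_number :: "('a,'b) pre_digraph \<Rightarrow> nat" where
  "chromatic_number G = (LEAST k. \<exists>c. proper_coloring G c \<and> num_colors G c = k)"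

definition totally_dominated_by :: "('a,'b) pre_digraph \<Rightarrow> 'a set set \<Rightarrow> bool" where
  "totally_dominated_by G F \<longleftrightarrow> (\<forall>v \<in> verts G. \<exists>A \<in> F. \<forall>w \<in> A. v \<rightarrow>\<^bsub>G\<^esub> w)"

definition td_coloring :: "('a,'b) pre_digraph \<Rightarrow> ('a \<Rightarrow> nat) \<Rightarrow> bool" where
  "td_coloring G c \<longleftrightarrow> proper_coloring G c \<and> totally_dominated_by G (color_classes G c)"

definition td_chromatic_number :: "('a,'b) pre_digraph \<Rightarrow> nat" where
  "td_chromatic_number G = (LEAST k. \<exists>c. td_coloring G c \<and> num_colors G c = k)"

definition min_dominating_classes :: "('a,'b) pre_digraph \<Rightarrow> ('a \<Rightarrow> nat) \<Rightarrow> nat" where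
  "min_dominating_classes G c =
     (LEAST n. \<exists>F \<subseteq> color_classes G c. totally_dominated_by G F \<and> card F = n)"

end

theory Submission
  imports Defs
begin

text \<open>
  The vertex set of a connected cograph with at least two vertices is the disjoint union of two
  nonempty sets \<open>A\<close> and \<open>B\<close> that are completely joined (Seinsche). Hence a color used on \<open>A\<close> does
  not occur on \<open>B\<close>, so in every proper coloring a class inside \<open>A\<close> is completely joined to all of
  \<open>B\<close> and a class inside \<open>B\<close> to all of \<open>A\<close>: every proper coloring is a TD-coloring, and two
  classes suffice. One class never suffices, as its own vertices are not dominated by it.
\<close>

text \<open>The relation is left arbitrary so that one notion covers both sides of the dichotomy:
  for adjacency it means that the graph is a join, for non-adjacency that it is
  disconnected.\<close>

definition splits :: "('a \<Rightarrow> 'a \<Rightarrow> bool) \<Rightarrow> 'a set \<Rightarrow> bool" where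
  "splits E V \<longleftrightarrow> (\<exists>A B. A \<noteq> {} \<and> B \<noteq> {} \<and> A \<inter> B = {} \<and> A \<union> B = V \<and> (\<forall>a\<in>A. \<forall>b\<in>B. E a b))"

lemma splitsI:
  assumes "A \<noteq> {}" "B \<noteq> {}" "A \<inter> B = {}" "A \<union> B = V" "\<And>a b. a \<in> A \<Longrightarrow> b \<in> B \<Longrightarrow> E a b"
  shows "splits E V"
  unfolding splits_def by (intro exI[of _ A] exI[of _ B] conjI ballI assms)

lemma splitsE:
  assumes "splits E V"
  obtains A B where "A \<noteq> {}" "B \<noteq> {}" "A \<inter> B = {}" "A \<union> B = V"
    "\<forall>a\<in>A. \<forall>b\<in>B. E a b"
  using assms unfolding splits_def by blast

text \<open>A relation on a set, not a graph, so that it passes to complements and to vertex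
  subsets. \<open>distinct\<close> makes the diagonal irrelevant, so a complement may contain
  loops.\<close>

definition P4_free_on :: "('a \<Rightarrow> 'a \<Rightarrow> bool) \<Rightarrow> 'a set \<Rightarrow> bool" where
  "P4_free_on E V \<longleftrightarrow> (\<forall>a\<in>V. \<forall>b\<in>V. \<forall>c\<in>V. \<forall>d\<in>V. distinct [a, b, c, d] \<longrightarrow>
     \<not> (E a b \<and> E b c \<and> E c d \<and> \<not> E a c \<and> \<not> E b d \<and> \<not> E a d))"

lemma P4_free_on_subset: "P4_free_on E V \<Longrightarrow> U \<subseteq> V \<Longrightarrow> P4_free_on E U"
  unfolding P4_free_on_def by (meson subsetD)

\<comment> \<open>The complement of the path \<open>a b c d\<close> is the path \<open>b d a c\<close>.\<close>
lemma P4_free_on_complement: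
  assumes "symp E" and "P4_free_on E V"
  shows "P4_free_on (\<lambda>x y. \<not> E x y) V"
  unfolding P4_free_on_def
proof (intro ballI impI notI)
  fix a b c d
  assume V: "a \<in> V" "b \<in> V" "c \<in> V" "d \<in> V" and dist: "distinct [a, b, c, d]"
    and path: "\<not> E a b \<and> \<not> E b c \<and> \<not> E c d \<and> \<not> \<not> E a c \<and> \<not> \<not> E b d \<and> \<not> \<not> E a d"
  have "distinct [b, d, a, c]"
    using dist by auto
  moreover have "E b d" "E d a" "E a c" "\<not> E b a" "\<not> E d c" "\<not> E b c"
    using path \<open>symp E\<close> by (auto dest: sympD)
  ultimately show False
    using \<open>P4_free_on E V\<close> V unfolding P4_free_on_def by blast
qed

text \<open>The non-neighbors \<open>N\<close> of \<open>v\<close> in \<open>A\<close> are cut off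
  from everything else: an edge from \<open>a\<close> in \<open>N\<close> to \<open>b\<close>
  outside \<open>N\<close> forces \<open>b\<close> into \<open>A\<close> and adjacent to
  \<open>v\<close>, and then \<open>z v b a\<close> is an induced path.\<close>

lemma splits_insert_nonneighbor:
  assumes sym: "symp E" and P4: "P4_free_on E (insert v (A \<union> B))"
    and v: "v \<notin> A \<union> B" and disj: "A \<inter> B = {}"
    and nonadj: "\<And>a b. a \<in> A \<Longrightarrow> b \<in> B \<Longrightarrow> \<not> E a b"
    and x: "x \<in> A" "\<not> E v x" and z: "z \<in> B" "E v z"
  shows "splits (\<lambda>x y. \<not> E x y) (insert v (A \<union> B))"
proof -
  define N where "N = {a \<in> A. \<not> E v a}"
  have "\<not> E a b" if "a \<in> N" "b \<in> insert v (A \<union> B) - N" for a b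
  proof
    assume ab: "E a b"
    have a: "a \<in> A" "\<not> E v a"
      using that by (auto simp: N_def)
    then have "b \<noteq> v"
      using ab sym by (auto dest: sympD)
    then have b: "b \<in> A" "E v b"
      using that ab nonadj a by (auto simp: N_def)
    have "distinct [z, v, b, a]"
      using a b z v disj by auto
    moreover have "E z v" "E b a" "\<not> E z b" "\<not> E z a"
      using a b ab z nonadj sym by (auto dest: sympD)
    ultimately show False
      using P4 a b z unfolding P4_free_on_def by blast
  qed
  moreover have "x \<in> N" "v \<in> insert v (A \<union> B) - N" "N \<subseteq> A"
    using x v by (auto simp: N_def)
  ultimately show ?thesis
    by (intro splitsI[of N "insert v (A \<union> B) - N"]) auto
qed

text \<open>If \<open>v\<close> sees all of \<open>V\<close>, it splits off as a join. If it sees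
  nothing of one side, it goes to the other side. Otherwise it has neighbors on both sides and a
  non-neighbor \<open>x\<close>, and the previous lemma applies to the side of
  \<open>x\<close>.\<close>

lemma splits_insert:
  assumes sym: "symp E" and P4: "P4_free_on E (insert v V)" and v: "v \<notin> V"
    and split: "splits (\<lambda>x y. \<not> E x y) V"
  shows "splits E (insert v V) \<or> splits (\<lambda>x y. \<not> E x y) (insert v V)"
proof -
  obtain A B where AB: "A \<noteq> {}" "B \<noteq> {}" "A \<inter> B = {}" "A \<union> B = V"
    and nonadj: "\<forall>a\<in>A. \<forall>b\<in>B. \<not> E a b"
    using split by (rule splitsE)
  have nonadj': "\<And>b a. b \<in> B \<Longrightarrow> a \<in> A \<Longrightarrow> \<not> E b a"
    using nonadj sym by (blast dest: sympD)
  consider "\<forall>a\<in>V. E v a" | "\<forall>a\<in>A. \<not> E v a" | "\<forall>b\<in>B. \<not> E v b"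
    | x y z where "x \<in> V" "\<not> E v x" "y \<in> A" "E v y" "z \<in> B" "E v z"
    by blast
  then show ?thesis
  proof cases
    case 1
    then have "splits E (insert v V)"
      using AB v by (intro splitsI[of "{v}" V]) auto
    then show ?thesis ..
  next
    case 2
    then have "splits (\<lambda>x y. \<not> E x y) (insert v V)"
      using AB v nonadj' by (intro splitsI[of "insert v B" A]) auto
    then show ?thesis ..
  next
    case 3
    then have "splits (\<lambda>x y. \<not> E x y) (insert v V)"
      using AB v nonadj by (intro splitsI[of "insert v A" B]) auto
    then show ?thesis ..
  next
    case 4
    show ?thesis
    proof (cases "x \<in> A")
      case True
      then show ?thesis
        using splits_insert_nonneighbor[OF sym, of v A B x z] 4 AB P4 v nonadj by simp
    next
      case False
      then have "x \<in> B"
        using 4 AB by blast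
      then show ?thesis
        using splits_insert_nonneighbor[OF sym, of v B A x y] 4 AB P4 v nonadj'
        by (simp add: Un_commute Int_commute)
    qed
  qed
qed

lemma P4_free_splits:
  assumes "finite V" "2 \<le> card V" "symp E" "P4_free_on E V"
  shows "splits E V \<or> splits (\<lambda>x y. \<not> E x y) V"
  using assms(1,2,4)
proof (induction V rule: finite_induct)
  case empty
  then show ?case by simp
next
  case (insert v V)
  show ?case
  proof (cases "2 \<le> card V")
    case False
    \<comment> \<open>Base case: two vertices form a join or a disconnected pair, according to
      whether they are adjacent.\<close>
    then obtain w where w: "V = {w}"
      using insert by (auto simp: card_Suc_eq numeral_2_eq_2 not_le less_Suc_eq_le le_Suc_eq)
    show ?thesis
      using insert.hyps w by (cases "E v w") (auto intro: splitsI[of "{v}" V])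
  next
    case True
    then have "splits E V \<or> splits (\<lambda>x y. \<not> E x y) V"
      using insert P4_free_on_subset by blast
    then show ?thesis
    proof
      \<comment> \<open>A join is disconnected in the complement, which is again free of induced
        paths on four vertices, so \<open>splits_insert\<close> applies there with the roles of its
        two outcomes exchanged.\<close>
      assume "splits E V"
      moreover have "symp (\<lambda>x y. \<not> E x y)"
        using \<open>symp E\<close> by (simp add: symp_def) blast
      moreover have "P4_free_on (\<lambda>x y. \<not> E x y) (insert v V)"
        using \<open>symp E\<close> insert.prems(2) by (rule P4_free_on_complement)
      ultimately show ?thesis
        using splits_insert[of "\<lambda>x y. \<not> E x y" v V] insert.hyps(2) by simp blast
    next
      assume "splits (\<lambda>x y. \<not> E x y) V"
      then show ?thesis
        using splits_insert[OF \<open>symp E\<close>] insert by blast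
    qed
  qed
qed

context graph
begin

lemma symp_adj: "symp (dominates G)"
  by (rule sympI) (rule graph_symmetric)

lemma cograph_P4_free:
  assumes "cograph G"
  shows "P4_free_on (dominates G) (verts G)"
  unfolding P4_free_on_def
proof (intro ballI impI notI)
  fix a b c d
  assume V: "a \<in> verts G" "b \<in> verts G" "c \<in> verts G" "d \<in> verts G"
    and dist: "distinct [a, b, c, d]"
    and path: "a \<rightarrow>\<^bsub>G\<^esub> b \<and> b \<rightarrow>\<^bsub>G\<^esub> c \<and> c \<rightarrow>\<^bsub>G\<^esub> d \<and> \<not> a \<rightarrow>\<^bsub>G\<^esub> c \<and> \<not> b \<rightarrow>\<^bsub>G\<^esub> d \<and> \<not> a \<rightarrow>\<^bsub>G\<^esub> d"
  have irrefl: "\<not> u \<rightarrow>\<^bsub>G\<^esub> u" for u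
    using adj_not_same by blast
  have sym: "u \<rightarrow>\<^bsub>G\<^esub> w \<longleftrightarrow> w \<rightarrow>\<^bsub>G\<^esub> u" for u w
    using graph_symmetric by blast
  have "induced_path G [a, b, c, d]"
    using V dist path irrefl sym[of b a] sym[of c b] sym[of d c] sym[of c a] sym[of d b] sym[of d a]
    unfolding induced_path_def by (simp add: All_less_Suc numeral_eq_Suc)
  then show False
    using assms unfolding cograph_def by (auto dest: spec[of _ "[a, b, c, d]"])
qed

lemma connected_not_splits:
  assumes "connected G"
  shows "\<not> splits (\<lambda>u v. \<not> u \<rightarrow>\<^bsub>G\<^esub> v) (verts G)"
proof
  assume "splits (\<lambda>u v. \<not> u \<rightarrow>\<^bsub>G\<^esub> v) (verts G)"
  then obtain A B where AB: "A \<noteq> {}" "B \<noteq> {}" "A \<inter> B = {}" "A \<union> B = verts G"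
    and nonadj: "\<forall>a\<in>A. \<forall>b\<in>B. \<not> a \<rightarrow>\<^bsub>G\<^esub> b"
    by (rule splitsE)
  obtain a b where ab: "a \<in> A" "b \<in> B"
    using AB by blast
  then have "a \<in> verts G" "b \<in> verts G"
    using AB by auto
  \<comment> \<open>\<open>connected\<close> refers to the symmetric closure; as the arcs are
    already symmetric, it yields reachability in \<open>G\<close> itself. A walk from
    \<open>a\<close> can then never leave \<open>A\<close>.\<close>
  then have "a \<rightarrow>\<^sup>*\<^bsub>G\<^esub> b"
    using symmetric_connected_imp_strongly_connected[OF sym_arcs assms]
    unfolding strongly_connected_def by simp
  then have "b \<in> A"
    using ab(1)
  proof (induction rule: reachable_induct)
    case (step x y)
    then show ?case
      using AB nonadj adj_in_verts(2)[of x y] by auto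
  qed
  then show False
    using AB ab by blast
qed

lemma connected_cograph_join:
  assumes "connected G" "cograph G" "2 \<le> card (verts G)"
  shows "splits (dominates G) (verts G)"
  using P4_free_splits[OF finite_verts assms(3) symp_adj cograph_P4_free[OF assms(2)]]
    connected_not_splits[OF assms(1)] by (simp only: simp_thms)

lemma join_two_classes_dominate:
  assumes "splits (dominates G) (verts G)" "proper_coloring G c"
  obtains F where "F \<subseteq> color_classes G c" "totally_dominated_by G F" "card F = 2"
proof -
  obtain A B where AB: "A \<noteq> {}" "B \<noteq> {}" "A \<inter> B = {}" "A \<union> B = verts G"
    and adj: "\<forall>a\<in>A. \<forall>b\<in>B. a \<rightarrow>\<^bsub>G\<^esub> b"
    using assms(1) by (rule splitsE)
  obtain a b where ab: "a \<in> A" "b \<in> B"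
    using AB by blast
  have colors: "c u \<noteq> c w" if "u \<in> A" "w \<in> B" for u w
    using that AB(4) adj[rule_format, OF that] assms(2) unfolding proper_coloring_def by auto
  let ?Fa = "color_class G c (c a)" and ?Fb = "color_class G c (c b)"
  have sub: "?Fa \<subseteq> A" "?Fb \<subseteq> B"
    \<comment> \<open>A vertex with the color of \<open>a\<close> outside \<open>A\<close> would lie
      in \<open>B\<close>, against \<open>colors\<close>; likewise for \<open>b\<close>.\<close>
    using ab AB colors colors[OF ab(1)] unfolding color_class_def by force+
  have mem: "a \<in> ?Fa" "b \<in> ?Fb"
    using ab AB by (auto simp: color_class_def)
  show thesis
  proof
    show "{?Fa, ?Fb} \<subseteq> color_classes G c"
      using ab AB unfolding color_classes_def by blast
    show "totally_dominated_by G {?Fa, ?Fb}"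
      unfolding totally_dominated_by_def
    proof
      fix v
      assume "v \<in> verts G"
      then consider "v \<in> A" | "v \<in> B"
        using AB by blast
      then show "\<exists>K\<in>{?Fa, ?Fb}. \<forall>w\<in>K. v \<rightarrow>\<^bsub>G\<^esub> w"
      proof cases
        case 1
        then show ?thesis using adj sub(2) by auto
      next
        case 2
        then show ?thesis using adj[rule_format, THEN graph_symmetric] sub(1) by auto
      qed
    qed
    \<comment> \<open>Nonempty subsets of disjoint sets differ.\<close>
    have "?Fa \<noteq> ?Fb"
      using mem sub AB by blast
    then show "card {?Fa, ?Fb} = 2"
      by simp
  qed
qed

lemma card_dominating_classes_ge_2:
  assumes "verts G \<noteq> {}" "F \<subseteq> color_classes G c" "totally_dominated_by G F"
  shows "2 \<le> card F"
proof (rule ccontr)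
  assume "\<not> 2 \<le> card F"
  \<comment> \<open>Rules out an infinite family, whose \<open>card\<close> would be 0 by
    convention.\<close>
  moreover have "finite F"
    using assms(2) by (rule finite_subset) (simp add: color_classes_def)
  moreover have "F \<noteq> {}"
    using assms(1,3) unfolding totally_dominated_by_def by blast
  ultimately have "card F = 1"
    using card_gt_0_iff[of F] by linarith
  then obtain K where K: "F = {K}"
    using card_1_singletonE by blast
  \<comment> \<open>Classes are formed only for colors that occur, so \<open>K\<close> has a vertex;
    dominating it would require a loop.\<close>
  then obtain v where "v \<in> K" "v \<in> verts G"
    using assms(2) unfolding color_classes_def color_class_def by blast
  then have "v \<rightarrow>\<^bsub>G\<^esub> v"
    using assms(3) K unfolding totally_dominated_by_def by blast
  then show False
    using adj_not_same by blast
qed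

end

theorem theorem5:
  fixes G :: "('a,'b) pre_digraph"
  assumes "graph G"
    and "Digraph_Component.connected G"
    and "cograph G"
    and "2 \<le> card (verts G)"
  shows "td_chromatic_number G = chromatic_number G \<and>
    (\<forall>c. td_coloring G c \<and> num_colors G c = td_chromatic_number G \<longrightarrow>
       min_dominating_classes G c = 2)"
proof -
  interpret graph G
    by fact
  have join: "splits (dominates G) (verts G)"
    using assms by (intro connected_cograph_join)
  have "totally_dominated_by G (color_classes G c)" if "proper_coloring G c" for c
  proof -
    obtain F where "F \<subseteq> color_classes G c" "totally_dominated_by G F"
      by (rule join_two_classes_dominate[OF join \<open>proper_coloring G c\<close>])
    then show ?thesis
      unfolding totally_dominated_by_def by (meson subsetD)
  qed
  \<comment> \<open>Both chromatic numbers are thus minima over the same set of colorings.\<close>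
  then have "td_coloring G c \<longleftrightarrow> proper_coloring G c" for c
    unfolding td_coloring_def by blast
  then have "td_chromatic_number G = chromatic_number G"
    by (simp add: td_chromatic_number_def chromatic_number_def)
  \<comment> \<open>Shown for every TD-coloring, whatever its number of colors.\<close>
  moreover have "min_dominating_classes G c = 2" if "td_coloring G c" for c
    unfolding min_dominating_classes_def
  proof (rule Least_equality)
    show "\<exists>F\<subseteq>color_classes G c. totally_dominated_by G F \<and> card F = 2"
      using join_two_classes_dominate[OF join, of c] that unfolding td_coloring_def by blast
    show "2 \<le> n" if F: "\<exists>F\<subseteq>color_classes G c. totally_dominated_by G F \<and> card F = n" for n
    proof -
      have "verts G \<noteq> {}"
        using assms(4) by auto
      then show ?thesis
        using F card_dominating_classes_ge_2 by metis
    qed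
  qed
  ultimately show ?thesis
    by blast
qed

end
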